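(* Let $A$ be an associative algebra and $M$ an $A$-bimodule. A pair $(T_1,T_2)$ of linear maps $T_1,T_2:M\to A$ is a compatible $\mathcal{O}$-operator on $M$ over $A$ if and only if $(T_1,T_2)\in C^1_{\mathrm{cO}}(M,A)$ is a Maurer-Cartan element of the graded Lie algebra $(C^\bullet_{\mathrm{cO}}(M,A),\llbracket\ ,\ \rrbracket)$, i.e. $\llbracket (T_1,T_2),(T_1,T_2)\rrbracket=0$.
   Context: All vector spaces are over a field $\mathbf{k}$ of characteristic $0$; $\cdot$ denotes the product of $A$ and both actions on $M$. An $\mathcal{O}$-operator on $M$ over $A$ is a linear map $T:M\to A$ with $T(u)\cdot T(v)=T(T(u)\cdot v+u\cdot T(v))$ for all $u,v\in M$. A compatible $\mathcal{O}$-operator is a pair $(T_1,T_2)$ of $\mathcal{O}$-operators such that for all $u,v\in M$ $$T_1(u)\cdot T_2(v)+T_2(u)\cdot T_1(v)=T_1(T_2(u)\cdot v+u\cdot T_2(v))+T_2(T_1(u)\cdot v+u\cdot T_1(v)).$$ On $\bigoplus_{n\ge0}\mathrm{Hom}(M^{\otimes n},A)$ (degree $n$ part $\mathrm{Hom}(M^{\otimes n},A)$, with $\mathrm{Hom}(M^{\otimes 0},A)=A$) there is a graded Lie bracket $[\ ,\ ]$: for $P\in\mathrm{Hom}(M^{\otimes m},A)$, $Q\in\mathrm{Hom}(M^{\otimes n},A)$, $m,n\ge1$, $$[P,Q](u_1,\ldots,u_{m+n})=\sum_{i=1}^m(-1)^{(i-1)n}P(u_1,\ldots,u_{i-1},Q(u_i,\ldots,u_{i+n-1})\cdot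 u_{i+n},\ldots,u_{m+n})$$ $$-\sum_{i=1}^m(-1)^{in}P(u_1,\ldots,u_{i-1},u_i\cdot Q(u_{i+1},\ldots,u_{i+n}),u_{i+n+1},\ldots,u_{m+n})$$ $$-(-1)^{mn}\Big\{\sum_{i=1}^n(-1)^{(i-1)m}Q(u_1,\ldots,u_{i-1},P(u_i,\ldots,u_{i+m-1})\cdot u_{i+m},\ldots,u_{m+n})-\sum_{i=1}^n(-1)^{im}Q(u_1,\ldots,u_{i-1},u_i\cdot P(u_{i+1},\ldots,u_{i+m}),u_{i+m+1},\ldots,u_{m+n})\Big\}$$ $$+(-1)^{mn}\big\{P(u_1,\ldots,u_m)\cdot Q(u_{m+1},\ldots,u_{m+n})-(-1)^{mn}Q(u_1,\ldots,u_n)\cdot P(u_{n+1},\ldots,u_{m+n})\big\},$$ and for $a,b\in A$: $[P,a](u_1,\ldots,u_m)=\sum_{i=1}^mP(u_1,\ldots,u_{i-1},a\cdot u_i-u_i\cdot a,u_{i+1},\ldots,u_m)+P(u_1,\ldots,u_m)\cdot a-a\cdot P(u_1,\ldots,u_m)$, $[a,b]=a\cdot b-b\cdot a$. Define $C^0_{\mathrm{cO}}(M,A)=A$ and, for $n\ge1$, $C^n_{\mathrm{cO}}(M,A)$ as the direct sum of $n+1$ copies of $\mathrm{Hom}(M^{\otimes n},A)$. The bracket $\llbracket\ ,\ \rrbracket$ of $(x_1,\ldots,x_{m+1})\in C^m_{\mathrm{cO}}$ and $(y_1,\ldots,y_{n+1})\in C^n_{\mathrm{cO}}$ is the element of $C^{m+n}_{\mathrm{cO}}$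 whose $i$-th entry ($1\le i\le m+n+1$) is $\sum_{p+q=i+1}[x_p,y_q]$ (over $1\le p\le m+1$, $1\le q\le n+1$). This makes $C^\bullet_{\mathrm{cO}}(M,A)$ a graded Lie algebra. A Maurer-Cartan element of a graded Lie algebra is a degree $1$ element $\theta$ with $\llbracket\theta,\theta\rrbracket=0$. *)

theory Defs
  imports Complex_Main
begin

(* Associative algebras are not assumed to be unital; the product is that of class ring. *)
locale assoc_algebra = vector_space scale
  for scale :: "'k::field_char_0 \<Rightarrow> 'a::ring \<Rightarrow> 'a" +
  assumes scale_mult_left: "scale c x * y = scale c (x * y)"
    and scale_mult_right: "x * scale c y = scale c (x * y)"

locale assoc_bimodule =
  A: assoc_algebra scaleA + M: vector_space scaleM
  for scaleA :: "'k::field_char_0 \<Rightarrow> 'a::ring \<Rightarrow> 'a"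
    and scaleM :: "'k \<Rightarrow> 'm::ab_group_add \<Rightarrow> 'm" +
  fixes lact :: "'a \<Rightarrow> 'm \<Rightarrow> 'm"  (infixr "\<rhd>" 75)
    and ract :: "'m \<Rightarrow> 'a \<Rightarrow> 'm"  (infixl "\<lhd>" 75)
  assumes linear_lact_left: "Vector_Spaces.linear scaleA scaleM (\<lambda>a. a \<rhd> u)"
    and linear_lact_right: "Vector_Spaces.linear scaleM scaleM (\<lambda>u. a \<rhd> u)"
    and linear_ract_left: "Vector_Spaces.linear scaleM scaleM (\<lambda>u. u \<lhd> a)"
    and linear_ract_right: "Vector_Spaces.linear scaleA scaleM (\<lambda>a. u \<lhd> a)"
    and lact_mult: "(a * b) \<rhd> u = a \<rhd> (b \<rhd> u)"
    and ract_mult: "u \<lhd> (a * b) = (u \<lhd> a) \<lhd> b"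
    and lact_ract: "(a \<rhd> u) \<lhd> b = a \<rhd> (u \<lhd> b)"
begin

definition O_operator :: "('m \<Rightarrow> 'a) \<Rightarrow> bool" where
  "O_operator T \<longleftrightarrow> Vector_Spaces.linear scaleM scaleA T \<and>
     (\<forall>u v. T u * T v = T (T u \<rhd> v + u \<lhd> T v))"

definition compatible_O_operator :: "('m \<Rightarrow> 'a) \<Rightarrow> ('m \<Rightarrow> 'a) \<Rightarrow> bool" where
  "compatible_O_operator T1 T2 \<longleftrightarrow> O_operator T1 \<and> O_operator T2 \<and>
     (\<forall>u v. T1 u * T2 v + T2 u * T1 v =
        T1 (T2 u \<rhd> v + u \<lhd> T2 v) + T2 (T1 u \<rhd> v + u \<lhd> T1 v))"

(* Elements of Hom (M^{(x)n}, A) are the n-linear maps, written as functions on lists of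
   length n and extended by 0 to all other lists, so that HOL equality is equality of maps.
   For n = 0 such a function is its value at the empty list, an element of A. *)
definition Hom_tensor :: "nat \<Rightarrow> ('m list \<Rightarrow> 'a) set" where
  "Hom_tensor n = {f. (\<forall>us. length us \<noteq> n \<longrightarrow> f us = 0) \<and>
     (\<forall>us i. length us = n \<longrightarrow> i < n \<longrightarrow>
        Vector_Spaces.linear scaleM scaleA (\<lambda>v. f (us[i := v])))}"

definition Hom1 :: "('m \<Rightarrow> 'a) \<Rightarrow> 'm list \<Rightarrow> 'a" where
  "Hom1 T us = (if length us = 1 then T (us ! 0) else 0)"

(* A need not contain 1, so signs act through the scalars. *)
abbreviation sgn_scale :: "nat \<Rightarrow> 'a \<Rightarrow> 'a" where
  "sgn_scale k x \<equiv> scaleA ((- 1) ^ k) x"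

(* sum over i = 1..m of
   (-1)^((i-1)n) P(u_1, ..., u_{i-1}, Q(u_i, ..., u_{i+n-1}) . u_{i+n}, ..., u_{m+n});
   the list us is indexed from 0, so u_j is us ! (j - 1). *)
definition insert_left :: "nat \<Rightarrow> nat \<Rightarrow> ('m list \<Rightarrow> 'a) \<Rightarrow> ('m list \<Rightarrow> 'a) \<Rightarrow> 'm list \<Rightarrow> 'a" where
  "insert_left m n P Q us = (\<Sum>i = 1..m. sgn_scale ((i - 1) * n)
     (P (take (i - 1) us @ [Q (take n (drop (i - 1) us)) \<rhd> us ! (i + n - 1)] @ drop (i + n) us)))"

(* sum over i = 1..m of
   (-1)^(in) P(u_1, ..., u_{i-1}, u_i . Q(u_{i+1}, ..., u_{i+n}), u_{i+n+1}, ..., u_{m+n}) *)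
definition insert_right :: "nat \<Rightarrow> nat \<Rightarrow> ('m list \<Rightarrow> 'a) \<Rightarrow> ('m list \<Rightarrow> 'a) \<Rightarrow> 'm list \<Rightarrow> 'a" where
  "insert_right m n P Q us = (\<Sum>i = 1..m. sgn_scale (i * n)
     (P (take (i - 1) us @ [us ! (i - 1) \<lhd> Q (take n (drop i us))] @ drop (i + n) us)))"

definition bracket_pos :: "nat \<Rightarrow> nat \<Rightarrow> ('m list \<Rightarrow> 'a) \<Rightarrow> ('m list \<Rightarrow> 'a) \<Rightarrow> 'm list \<Rightarrow> 'a" where
  "bracket_pos m n P Q us =
     insert_left m n P Q us - insert_right m n P Q us
     - sgn_scale (m * n) (insert_left n m Q P us - insert_right n m Q P us)
     + sgn_scale (m * n)
         (P (take m us) * Q (drop m us) - sgn_scale (m * n) (Q (take n us) * P (drop n us)))"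

definition bracket_elem :: "nat \<Rightarrow> ('m list \<Rightarrow> 'a) \<Rightarrow> 'a \<Rightarrow> 'm list \<Rightarrow> 'a" where
  "bracket_elem m P a us =
     (\<Sum>i = 1..m. P (us[i - 1 := a \<rhd> us ! (i - 1) - us ! (i - 1) \<lhd> a])) + P us * a - a * P us"

(* The bracket of P in degree m and Q in degree n; [a, P] = - [P, a] for a in degree 0
   by graded antisymmetry. *)
definition Hom_bracket :: "nat \<Rightarrow> nat \<Rightarrow> ('m list \<Rightarrow> 'a) \<Rightarrow> ('m list \<Rightarrow> 'a) \<Rightarrow> 'm list \<Rightarrow> 'a" where
  "Hom_bracket m n P Q us =
     (if length us \<noteq> m + n then 0
      else if m = 0 \<and> n = 0 then P [] * Q [] - Q [] * P []
      else if n = 0 then bracket_elem m P (Q []) us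
      else if m = 0 then - bracket_elem n Q (P []) us
      else bracket_pos m n P Q us)"

definition cO_cochains :: "nat \<Rightarrow> ('m list \<Rightarrow> 'a) list set" where
  "cO_cochains n = {x. length x = n + 1 \<and> set x \<subseteq> Hom_tensor n}"

definition cO_zero :: "nat \<Rightarrow> ('m list \<Rightarrow> 'a) list" where
  "cO_zero n = replicate (n + 1) (\<lambda>us. 0)"

(* Entries are numbered from 1, so x_p is x ! (p - 1). *)
definition cO_bracket ::
  "nat \<Rightarrow> nat \<Rightarrow> ('m list \<Rightarrow> 'a) list \<Rightarrow> ('m list \<Rightarrow> 'a) list \<Rightarrow> ('m list \<Rightarrow> 'a) list" where
  "cO_bracket m n x y =
     map (\<lambda>i us. \<Sum>(p, q) \<in> {(p, q). p \<in> {1..m + 1} \<and> q \<in> {1..n + 1} \<and> p + q = i + 1}.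
            Hom_bracket m n (x ! (p - 1)) (y ! (q - 1)) us)
         [1..<m + n + 2]"

end

(* Here a graded Lie algebra is presented by its homogeneous components C n, their zeros z n
   and the brackets br m n : C m x C n --> C (m + n). *)
definition maurer_cartan ::
  "(nat \<Rightarrow> 'x set) \<Rightarrow> (nat \<Rightarrow> 'x) \<Rightarrow> (nat \<Rightarrow> nat \<Rightarrow> 'x \<Rightarrow> 'x \<Rightarrow> 'x) \<Rightarrow> 'x \<Rightarrow> bool" where
  "maurer_cartan C z br \<theta> \<longleftrightarrow> \<theta> \<in> C 1 \<and> br 1 1 \<theta> \<theta> = z 2"

end

theory Submission
  imports Defs
begin

text \<open>
  On a pair \<open>(u, v)\<close> every sum in the bracket of two degree 1 elements has a single summand, and
  the signs turn the bracket \<open>[P, Q]\<close> into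
  \<open>P (Q u \<rhd> v + u \<lhd> Q v) + Q (P u \<rhd> v + u \<lhd> P v) - (P u * Q v + Q u * P v)\<close>
  (lemma \<open>Hom_bracket_Hom1\<close>). This expression, the O-defect of \<open>P\<close> and \<open>Q\<close>, is
  symmetric. The defect of \<open>T\<close> with itself is twice the obstruction to \<open>T\<close> being an O-operator,
  and the defect of \<open>T1\<close> and \<open>T2\<close> is the obstruction to their compatibility. By symmetry, the three
  entries of the bracket of \<open>(T1, T2)\<close> with itself are the defect of \<open>T1\<close>, twice the mixed defect,
  and the defect of \<open>T2\<close>. In characteristic 0 the factors 2 can be cancelled, so the bracket
  vanishes exactly when the three defining equations of a compatible O-operator hold.
\<close>

context assoc_bimodule
begin

definition O_defect :: "('m \<Rightarrow> 'a) \<Rightarrow> ('m \<Rightarrow> 'a) \<Rightarrow> 'm \<Rightarrow> 'm \<Rightarrow> 'a" where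
  "O_defect P Q u v = P (Q u \<rhd> v + u \<lhd> Q v) + Q (P u \<rhd> v + u \<lhd> P v) - (P u * Q v + Q u * P v)"

lemma O_defect_commute: "O_defect P Q u v = O_defect Q P u v"
  by (simp add: O_defect_def algebra_simps)

text \<open>This is where characteristic 0 enters.\<close>

lemma add_self_eq_0_iff: "x + x = 0 \<longleftrightarrow> x = 0" for x :: 'a
proof -
  have "x + x = scaleA 2 x"
    using A.scale_left_distrib[of 1 1 x] by simp
  then show ?thesis by simp
qed

lemma Hom1_in_Hom_tensor:
  assumes "Vector_Spaces.linear scaleM scaleA T"
  shows "Hom1 T \<in> Hom_tensor 1"
  using assms by (auto simp: Hom_tensor_def Hom1_def)

lemma Hom_bracket_Hom1:
  assumes P: "Vector_Spaces.linear scaleM scaleA P"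
    and Q: "Vector_Spaces.linear scaleM scaleA Q"
  shows "Hom_bracket 1 1 (Hom1 P) (Hom1 Q) [u, v] = O_defect P Q u v"
proof -
  interpret P: Vector_Spaces.linear scaleM scaleA P by (fact P)
  interpret Q: Vector_Spaces.linear scaleM scaleA Q by (fact Q)
  show ?thesis
    by (simp add: Hom_bracket_def bracket_pos_def insert_left_def insert_right_def Hom1_def
        O_defect_def P.add Q.add)
qed

lemma Hom_bracket_Hom1_eq_0_iff:
  assumes "Vector_Spaces.linear scaleM scaleA P"
    and "Vector_Spaces.linear scaleM scaleA Q"
  shows "(\<forall>us. Hom_bracket 1 1 (Hom1 P) (Hom1 Q) us = 0) \<longleftrightarrow> (\<forall>u v. O_defect P Q u v = 0)"
proof
  assume "\<forall>us. Hom_bracket 1 1 (Hom1 P) (Hom1 Q) us = 0"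
  then show "\<forall>u v. O_defect P Q u v = 0"
    using Hom_bracket_Hom1[OF assms] by metis
next
  assume defect: "\<forall>u v. O_defect P Q u v = 0"
  show "\<forall>us. Hom_bracket 1 1 (Hom1 P) (Hom1 Q) us = 0"
  proof
    fix us :: "'m list"
    show "Hom_bracket 1 1 (Hom1 P) (Hom1 Q) us = 0"
    proof (cases "length us = 2")
      case True
      then obtain u v where "us = [u, v]"
        by (auto simp: numeral_2_eq_2 length_Suc_conv)
      then show ?thesis
        using defect Hom_bracket_Hom1[OF assms] by metis
    next
      case False
      then show ?thesis by (simp add: Hom_bracket_def)
    qed
  qed
qed

lemma O_operator_iff_defect:
  assumes "Vector_Spaces.linear scaleM scaleA T"
  shows "O_operator T \<longleftrightarrow> (\<forall>u v. O_defect T T u v = 0)"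
proof -
  have "O_defect T T u v = 0 \<longleftrightarrow> T u * T v = T (T u \<rhd> v + u \<lhd> T v)" for u v
  proof -
    define x where "x = T (T u \<rhd> v + u \<lhd> T v) - T u * T v"
    have "O_defect T T u v = x + x"
      by (simp add: O_defect_def x_def)
    then show ?thesis
      by (auto simp: add_self_eq_0_iff x_def)
  qed
  then show ?thesis
    using assms by (simp add: O_operator_def)
qed

lemma compatible_O_operator_iff_defect:
  assumes "Vector_Spaces.linear scaleM scaleA T1"
    and "Vector_Spaces.linear scaleM scaleA T2"
  shows "compatible_O_operator T1 T2 \<longleftrightarrow> (\<forall>u v. O_defect T1 T1 u v = 0) \<and>
    (\<forall>u v. O_defect T1 T2 u v = 0) \<and> (\<forall>u v. O_defect T2 T2 u v = 0)"
proof -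
  have "O_defect T1 T2 u v = 0 \<longleftrightarrow> T1 u * T2 v + T2 u * T1 v =
      T1 (T2 u \<rhd> v + u \<lhd> T2 v) + T2 (T1 u \<rhd> v + u \<lhd> T1 v)" for u v
    unfolding O_defect_def by auto
  then show ?thesis
    using assms by (auto simp: compatible_O_operator_def O_operator_iff_defect)
qed

lemma cO_bracket_degree_1:
  "cO_bracket 1 1 [x1, x2] [y1, y2] =
    [Hom_bracket 1 1 x1 y1,
     \<lambda>us. Hom_bracket 1 1 x1 y2 us + Hom_bracket 1 1 x2 y1 us,
     Hom_bracket 1 1 x2 y2]"
proof -
  have index_sets:
    "{(p::nat, q::nat). p \<in> {1..1 + 1} \<and> q \<in> {1..1 + 1} \<and> p + q = 1 + 1} = {(1, 1)}"
    "{(p::nat, q::nat). p \<in> {1..1 + 1} \<and> q \<in> {1..1 + 1} \<and> p + q = 2 + 1} = {(1, 2), (2, 1)}"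
    "{(p::nat, q::nat). p \<in> {1..1 + 1} \<and> q \<in> {1..1 + 1} \<and> p + q = 3 + 1} = {(2, 2)}"
    by auto
  have entries: "[1..<1 + 1 + 2] = [1, 2, 3]"
    by (simp add: upt_rec)
  show ?thesis
    unfolding cO_bracket_def entries list.map index_sets by simp
qed

theorem compatible_O_operator_iff_maurer_cartan:
  assumes T1: "Vector_Spaces.linear scaleM scaleA T1"
    and T2: "Vector_Spaces.linear scaleM scaleA T2"
  shows "compatible_O_operator T1 T2 \<longleftrightarrow>
    maurer_cartan cO_cochains cO_zero cO_bracket [Hom1 T1, Hom1 T2]"
proof -
  let ?B = "Hom_bracket 1 1"
  have cochain: "[Hom1 T1, Hom1 T2] \<in> cO_cochains 1"
    using Hom1_in_Hom_tensor[OF T1] Hom1_in_Hom_tensor[OF T2] by (simp add: cO_cochains_def)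
  have symmetric: "?B (Hom1 T2) (Hom1 T1) us = ?B (Hom1 T1) (Hom1 T2) us" for us
  proof (cases "length us = 2")
    case True
    then obtain u v where "us = [u, v]"
      by (auto simp: numeral_2_eq_2 length_Suc_conv)
    then show ?thesis
      using Hom_bracket_Hom1[OF T1 T2] Hom_bracket_Hom1[OF T2 T1] O_defect_commute by metis
  next
    case False
    then show ?thesis by (simp add: Hom_bracket_def)
  qed
  have zero: "cO_zero 2 = [\<lambda>us. 0, \<lambda>us. 0, \<lambda>us. 0]"
    by (simp add: cO_zero_def numeral_eq_Suc)
  have "maurer_cartan cO_cochains cO_zero cO_bracket [Hom1 T1, Hom1 T2] \<longleftrightarrow>
      cO_bracket 1 1 [Hom1 T1, Hom1 T2] [Hom1 T1, Hom1 T2] = cO_zero 2"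
    using cochain by (simp add: maurer_cartan_def)
  also have "\<dots> \<longleftrightarrow> (\<forall>us. ?B (Hom1 T1) (Hom1 T1) us = 0) \<and>
      (\<forall>us. ?B (Hom1 T1) (Hom1 T2) us = 0) \<and> (\<forall>us. ?B (Hom1 T2) (Hom1 T2) us = 0)"
    unfolding cO_bracket_degree_1 zero symmetric add_self_eq_0_iff list.inject fun_eq_iff by blast
  also have "\<dots> \<longleftrightarrow> compatible_O_operator T1 T2"
    using T1 T2 by (simp only: Hom_bracket_Hom1_eq_0_iff compatible_O_operator_iff_defect)
  finally show ?thesis by (rule sym)
qed

end

theorem mainTheorem4:
  fixes scaleA :: "'k::field_char_0 \<Rightarrow> 'a::ring \<Rightarrow> 'a"
    and scaleM :: "'k \<Rightarrow> 'm::ab_group_add \<Rightarrow> 'm"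
    and lact :: "'a \<Rightarrow> 'm \<Rightarrow> 'm"
    and ract :: "'m \<Rightarrow> 'a \<Rightarrow> 'm"
    and T1 T2 :: "'m \<Rightarrow> 'a"
  assumes "assoc_bimodule scaleA scaleM lact ract"
    and "Vector_Spaces.linear scaleM scaleA T1"
    and "Vector_Spaces.linear scaleM scaleA T2"
  shows "assoc_bimodule.compatible_O_operator scaleA scaleM lact ract T1 T2 \<longleftrightarrow>
    maurer_cartan (assoc_bimodule.cO_cochains scaleA scaleM) assoc_bimodule.cO_zero
      (assoc_bimodule.cO_bracket scaleA lact ract)
      [assoc_bimodule.Hom1 T1, assoc_bimodule.Hom1 T2]"
  using assms by (rule assoc_bimodule.compatible_O_operator_iff_maurer_cartan)

end
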